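(* Let $(X,\mathcal E)$ be an infinite locally finite connected graph with symmetric edge weights $\mu_{xy}=\mu_{yx}>0$, fix $x_0\in X$, and let $G_j$ be the Dirichlet Green function of the ball $B(j)$ centered at $x_0$. Assume that there exists a positive function $\phi:X\to(0,\infty)$ such that $\Delta\phi\le0$ on $X$ and $\phi(x)\to0$ as $d(x,x_0)\to\infty$. Then the (finite) limit $G(x,y)=\lim_{j\to\infty}G_j(x,y)$ exists for any $x\ne y$ in $X$, and $G(x,y)$ is the Green function on $X$.
   Context: A locally finite connected graph $(X,\mathcal E)$ is a simple (no loops, no multiple edges), connected graph with countable vertex set $X$ and edge set $\mathcal E$ in which each vertex has finitely many neighbors. It carries a symmetric weight $\mu_{xy}=\mu_{yx}>0$ on $\mathcal E$, and $d_x=\sum_{y:(x,y)\in\mathcal E}\mu_{xy}<\infty$ is the degree of $x$; $d(x,y)$ is the graph distance. For $u:X\to\mathbb R$, $(\Delta u)(x)=\sum_{y:(x,y)\in\mathcal E}\frac{\mu_{xy}}{d_x}(u(y)-u(x))$. Let $p(x,y)=\mu_{xy}/d_x$ if $(x,y)\in\mathcal E$ and $0$ otherwise, $Pf(x)=\sum_yp(x,y)f(y)$ (so $\Delta=P-I$), and let $p_n(x,y)$ be the $n$-step transition probabilities (matrix entries of $P^n$, $P^0=I$). If $\sum_{n\ge0}p_n(x,y)<\infty$ for all $x,y\in X$ (transience), the (global) Green function on $X$ is $G(x,y)=\sum_{n\ge0}p_n(x,y)$; it satisfies $(I-P)G=I$. Being the Green function on $X$ includes the finiteness of this sum. For a finite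 set $S\subset X$ inducing a connected subgraph, with boundary $\delta S$ the set of vertices not in $S$ adjacent to some vertex of $S$, the Dirichlet Green function $G_S$ is obtained by the same construction with $P$ replaced by its restriction $(p(x,y))_{x,y\in S}$ to $S$, extended by $0$ outside $S$; thus $-\Delta G_S(\cdot,y)=\delta_y$ on $S$ and $G_S(\cdot,y)=0$ on $\delta S$ for $y\in S$. Put $B(j)=\{x\in X:d(x,x_0)<j\}$ and $G_j=G_{B(j)}$; then $0\le G_j\le G_{j+1}$. *)

theory Defs
  imports "HOL-Analysis.Analysis"
begin

text \<open>The edge set is a symmetric irreflexive relation \<open>E\<close>, so each undirected edge
  occurs as two ordered pairs; the values of \<open>\<mu>\<close> off \<open>E\<close> are irrelevant.\<close>

locale weighted_graph =
  fixes V :: "'a set" and E :: "('a \<times> 'a) set" and \<mu> :: "'a \<Rightarrow> 'a \<Rightarrow> real"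
  assumes countable_V: "countable V"
    and E_subset: "E \<subseteq> V \<times> V"
    and sym_E: "sym E"
    and irrefl_E: "irrefl E"
    and locally_finite: "\<And>x. x \<in> V \<Longrightarrow> finite (E `` {x})"
    and connected_E: "\<And>x y. x \<in> V \<Longrightarrow> y \<in> V \<Longrightarrow> (x, y) \<in> E\<^sup>*"
    and \<mu>_pos: "\<And>x y. (x, y) \<in> E \<Longrightarrow> \<mu> x y > 0"
    and \<mu>_sym: "\<And>x y. (x, y) \<in> E \<Longrightarrow> \<mu> x y = \<mu> y x"

definition degree :: "('a \<times> 'a) set \<Rightarrow> ('a \<Rightarrow> 'a \<Rightarrow> real) \<Rightarrow> 'a \<Rightarrow> real" where
  "degree E \<mu> x = (\<Sum>y\<in>E `` {x}. \<mu> x y)"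

definition laplacian ::
    "('a \<times> 'a) set \<Rightarrow> ('a \<Rightarrow> 'a \<Rightarrow> real) \<Rightarrow> ('a \<Rightarrow> real) \<Rightarrow> 'a \<Rightarrow> real" where
  "laplacian E \<mu> u x = (\<Sum>y\<in>E `` {x}. \<mu> x y / degree E \<mu> x * (u y - u x))"

text \<open>Only meaningful for vertices joined by a path.\<close>

definition graph_dist :: "('a \<times> 'a) set \<Rightarrow> 'a \<Rightarrow> 'a \<Rightarrow> nat" where
  "graph_dist E x y = (LEAST n. (x, y) \<in> E ^^ n)"

definition graph_ball :: "'a set \<Rightarrow> ('a \<times> 'a) set \<Rightarrow> 'a \<Rightarrow> nat \<Rightarrow> 'a set" where
  "graph_ball V E x\<^sub>0 j = {x \<in> V. graph_dist E x x\<^sub>0 < j}"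

definition transition ::
    "('a \<times> 'a) set \<Rightarrow> ('a \<Rightarrow> 'a \<Rightarrow> real) \<Rightarrow> 'a \<Rightarrow> 'a \<Rightarrow> real" where
  "transition E \<mu> x y = (if (x, y) \<in> E then \<mu> x y / degree E \<mu> x else 0)"

text \<open>Entries of the \<open>n\<close>-th power of the matrix \<open>(K x y)\<close> with \<open>x, y \<in> A\<close>; meaningful for
  \<open>x, y \<in> A\<close>. For the transition kernel of a locally finite graph the sum has only
  finitely many nonzero terms, also when \<open>A\<close> is infinite.\<close>

primrec kernel_power :: "'a set \<Rightarrow> ('a \<Rightarrow> 'a \<Rightarrow> real) \<Rightarrow> nat \<Rightarrow> 'a \<Rightarrow> 'a \<Rightarrow> real" where
  "kernel_power A K 0 x y = (if x = y then 1 else 0)"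
| "kernel_power A K (Suc n) x y = (\<Sum>\<^sub>\<infinity>z\<in>A. K x z * kernel_power A K n z y)"

definition transient :: "'a set \<Rightarrow> ('a \<times> 'a) set \<Rightarrow> ('a \<Rightarrow> 'a \<Rightarrow> real) \<Rightarrow> bool" where
  "transient V E \<mu> \<longleftrightarrow>
     (\<forall>x\<in>V. \<forall>y\<in>V. summable (\<lambda>n. kernel_power V (transition E \<mu>) n x y))"

text \<open>For \<open>A = V\<close> this is the global Green function, provided the graph is \<open>transient\<close>;
  for finite \<open>A\<close> it is the Dirichlet Green function of \<open>A\<close>, extended by \<open>0\<close>.\<close>

definition green ::
    "'a set \<Rightarrow> ('a \<times> 'a) set \<Rightarrow> ('a \<Rightarrow> 'a \<Rightarrow> real) \<Rightarrow> 'a \<Rightarrow> 'a \<Rightarrow> real" where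
  "green A E \<mu> x y =
     (if x \<in> A \<and> y \<in> A then (\<Sum>n. kernel_power A (transition E \<mu>) n x y) else 0)"

end

theory Submission
  imports Defs
begin

text \<open>Since \<open>\<phi>\<close> vanishes at infinity it attains its maximum, so by the strong maximum
  principle it cannot be harmonic: \<open>\<Delta>\<phi>(z) < 0\<close> for some \<open>z\<close>. Iterating \<open>P\<phi> \<le> \<phi> + \<Delta>\<phi>\<close> bounds
  \<open>-\<Delta>\<phi>(z) \<Sum>\<^sub>n p\<^sub>n(x, z)\<close> by \<open>\<phi>(x)\<close>. Connectedness spreads this summability to all targets
  \<open>y\<close>, and then \<open>G\<^sub>j \<rightarrow> G\<close> by dominated convergence, because every fixed entry of the \<open>n\<close>-th
  power of the restricted kernel is eventually equal to \<open>p\<^sub>n(x, y)\<close>.\<close>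

context weighted_graph
begin

abbreviation p :: "'a \<Rightarrow> 'a \<Rightarrow> real" where
  "p \<equiv> transition E \<mu>"

abbreviation step :: "'a set \<Rightarrow> nat \<Rightarrow> 'a \<Rightarrow> 'a \<Rightarrow> real" where
  "step A \<equiv> kernel_power A p"

section \<open>One-step transition probabilities\<close>

lemma neighbours_subset: "E `` {x} \<subseteq> V"
  using E_subset by auto

lemma degree_pos:
  assumes "(x, y) \<in> E"
  shows "degree E \<mu> x > 0"
  unfolding degree_def
  by (rule sum_pos2[of _ y])
    (use assms E_subset locally_finite in \<open>auto dest: \<mu>_pos intro: less_imp_le\<close>)

lemma transition_pos:
  assumes "(x, y) \<in> E"
  shows "p x y > 0"
  using assms degree_pos[OF assms] \<mu>_pos[OF assms] by (simp add: transition_def)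

lemma transition_nonneg: "p x y \<ge> 0"
  using transition_pos[of x y] by (auto simp: transition_def intro: less_imp_le)

text \<open>Only an inequality, since at a point without neighbours the degree is 0 and the quotient
  \<open>0 / 0\<close> evaluates to 0.\<close>

lemma transition_sum_le_1: "(\<Sum>y\<in>E `` {x}. p x y) \<le> 1"
proof -
  have "(\<Sum>y\<in>E `` {x}. p x y) = degree E \<mu> x / degree E \<mu> x"
    by (simp add: transition_def degree_def flip: sum_divide_distrib)
  also have "\<dots> \<le> 1"
    by simp
  finally show ?thesis .
qed

lemma laplacian_eq: "laplacian E \<mu> u x = (\<Sum>y\<in>E `` {x}. p x y * (u y - u x))"
  unfolding laplacian_def by (intro sum.cong) (auto simp: transition_def)

lemma transition_sum_le:
  assumes "u x \<ge> 0"
  shows "(\<Sum>y\<in>E `` {x}. p x y * u y) \<le> u x + laplacian E \<mu> u x"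
proof -
  have "(\<Sum>y\<in>E `` {x}. p x y * u y) = (\<Sum>y\<in>E `` {x}. p x y) * u x + laplacian E \<mu> u x"
    by (simp add: laplacian_eq algebra_simps sum_subtractf sum_distrib_left)
  also have "(\<Sum>y\<in>E `` {x}. p x y) * u x \<le> u x"
    using mult_right_mono[OF transition_sum_le_1 assms] by simp
  finally show ?thesis
    by simp
qed

section \<open>Powers of the full and the restricted kernel\<close>

text \<open>The kernel vanishes off the neighbours of \<open>x\<close>, so local finiteness makes
  the infinite sum finite. The starting point has to lie in \<open>V\<close> only, which lets later
  inductions on \<open>n\<close> ignore whether it is in \<open>A\<close>.\<close>

lemma step_Suc:
  assumes "x \<in> V"
  shows "step A (Suc n) x y = (\<Sum>z\<in>E `` {x} \<inter> A. p x z * step A n z y)"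
proof -
  have "step A (Suc n) x y = (\<Sum>\<^sub>\<infinity>z\<in>E `` {x} \<inter> A. p x z * step A n z y)"
    by (simp, intro infsum_cong_neutral) (auto simp: transition_def)
  then show ?thesis
    using locally_finite[OF assms] by simp
qed

lemma step_V_Suc:
  assumes "x \<in> V"
  shows "step V (Suc n) x y = (\<Sum>z\<in>E `` {x}. p x z * step V n z y)"
  using step_Suc[OF assms, of V] neighbours_subset[of x] by (simp add: inf.absorb1)

declare kernel_power.simps(2) [simp del]

lemma step_nonneg: "x \<in> V \<Longrightarrow> step A n x y \<ge> 0"
proof (induction n arbitrary: x)
  case (Suc n)
  then show ?case
    using neighbours_subset
    by (auto simp: step_Suc intro!: sum_nonneg mult_nonneg_nonneg transition_nonneg)
qed simp

lemma step_le: "x \<in> V \<Longrightarrow> step A n x y \<le> step V n x y"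
proof (induction n arbitrary: x)
  case (Suc n)
  have "step A (Suc n) x y = (\<Sum>z\<in>E `` {x} \<inter> A. p x z * step A n z y)"
    using Suc.prems by (rule step_Suc)
  also have "\<dots> \<le> (\<Sum>z\<in>E `` {x} \<inter> A. p x z * step V n z y)"
    using Suc.IH neighbours_subset by (intro sum_mono mult_left_mono transition_nonneg) blast
  also have "\<dots> \<le> (\<Sum>z\<in>E `` {x}. p x z * step V n z y)"
    using neighbours_subset Suc.prems
    by (intro sum_mono2 locally_finite mult_nonneg_nonneg transition_nonneg step_nonneg) auto
  also have "\<dots> = step V (Suc n) x y"
    using Suc.prems by (simp add: step_V_Suc)
  finally show ?case .
qed simp

text \<open>Among the walks from \<open>x\<close> to \<open>z\<close>, keep only those whose last
  step is the edge from \<open>y\<close>. Induction is needed because \<open>kernel_power\<close>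
  peels off the first step, not the last.\<close>

lemma step_mult_transition_le:
  assumes "(y, z) \<in> E"
  shows "x \<in> V \<Longrightarrow> step V n x y * p y z \<le> step V (Suc n) x z"
proof (induction n arbitrary: x)
  case 0
  have "p y z = (\<Sum>w\<in>{z}. p y w * step V 0 w z)"
    by simp
  also have "\<dots> \<le> (\<Sum>w\<in>E `` {y}. p y w * step V 0 w z)"
    using assms E_subset by (intro sum_mono2 locally_finite) (auto simp: transition_nonneg)
  also have "\<dots> = step V (Suc 0) y z"
    using assms E_subset by (intro step_V_Suc[symmetric]) auto
  finally show ?case
    using step_nonneg[OF 0] by auto
next
  case (Suc n)
  have "step V (Suc n) x y * p y z = (\<Sum>w\<in>E `` {x}. p x w * (step V n w y * p y z))"
    using Suc.prems by (simp add: step_V_Suc sum_distrib_right mult.assoc)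
  also have "\<dots> \<le> (\<Sum>w\<in>E `` {x}. p x w * step V (Suc n) w z)"
    using Suc.IH neighbours_subset by (intro sum_mono mult_left_mono transition_nonneg) blast
  also have "\<dots> = step V (Suc (Suc n)) x z"
    using Suc.prems by (rule step_V_Suc[symmetric])
  finally show ?case .
qed

section \<open>Summability of the Green series\<close>

lemma summable_step_edge:
  assumes "(y, z) \<in> E" "x \<in> V" "summable (\<lambda>n. step V n x z)"
  shows "summable (\<lambda>n. step V n x y)"
proof (rule summable_comparison_test)
  show "summable (\<lambda>n. step V (Suc n) x z / p y z)"
    by (rule summable_divide[OF summable_Suc_iff[THEN iffD2, OF assms(3)]])
  have "step V n x y \<le> step V (Suc n) x z / p y z" for n
    using step_mult_transition_le[OF assms(1,2), of n] transition_pos[OF assms(1)]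
    by (simp add: pos_le_divide_eq)
  then show "\<exists>N. \<forall>n\<ge>N. norm (step V n x y) \<le> step V (Suc n) x z / p y z"
    using step_nonneg[OF assms(2)] by simp
qed

text \<open>With \<open>c\<close> denoting the factor in front, the partial sums satisfy
  \<open>S (N + 1) = \<delta>_z + P (S N)\<close>, so \<open>c * S N \<le> \<phi>\<close> is
  inherited from \<open>N\<close> to \<open>N + 1\<close> through the superharmonicity of
  \<open>\<phi>\<close>.\<close>

lemma partial_green_sum_le:
  assumes "\<And>x. x \<in> V \<Longrightarrow> \<phi> x \<ge> 0" "\<And>x. x \<in> V \<Longrightarrow> laplacian E \<mu> \<phi> x \<le> 0"
  shows "x \<in> V \<Longrightarrow> - laplacian E \<mu> \<phi> z * (\<Sum>n<N. step V n x z) \<le> \<phi> x"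
proof (induction N arbitrary: x)
  case 0
  then show ?case
    using assms(1) by simp
next
  case (Suc N)
  define c where "c = - laplacian E \<mu> \<phi> z"
  have "(\<Sum>n<N. step V (Suc n) x z) = (\<Sum>n<N. \<Sum>w\<in>E `` {x}. p x w * step V n w z)"
    using Suc.prems by (simp add: step_V_Suc)
  also have "\<dots> = (\<Sum>w\<in>E `` {x}. p x w * (\<Sum>n<N. step V n w z))"
    by (subst sum.swap) (simp add: sum_distrib_left)
  finally have "c * (\<Sum>n<Suc N. step V n x z)
      = c * step V 0 x z + (\<Sum>w\<in>E `` {x}. p x w * (c * (\<Sum>n<N. step V n w z)))"
    by (simp only: sum.lessThan_Suc_shift distrib_left sum_distrib_left mult.left_commute)
  also have "\<dots> \<le> c * step V 0 x z + (\<Sum>w\<in>E `` {x}. p x w * \<phi> w)"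
    using Suc.IH neighbours_subset
    by (intro add_left_mono sum_mono mult_left_mono transition_nonneg) (auto simp: c_def)
  also have "\<dots> \<le> c * step V 0 x z + (\<phi> x + laplacian E \<mu> \<phi> x)"
    using transition_sum_le[of \<phi> x] assms(1)[OF Suc.prems] by simp
  \<comment> \<open>At \<open>x = z\<close> the source term \<open>c\<close> cancels the Laplacian
    exactly; elsewhere it is 0 and the Laplacian is nonpositive.\<close>
  also have "\<dots> \<le> \<phi> x"
    using assms(2)[OF Suc.prems] by (auto simp: c_def)
  finally show ?case
    unfolding c_def .
qed

lemma transient_if_strictly_superharmonic:
  assumes "\<And>x. x \<in> V \<Longrightarrow> \<phi> x \<ge> 0" "\<And>x. x \<in> V \<Longrightarrow> laplacian E \<mu> \<phi> x \<le> 0"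
    and "z \<in> V" "laplacian E \<mu> \<phi> z < 0"
  shows "transient V E \<mu>"
  unfolding transient_def
proof (intro ballI)
  fix x y
  assume x: "x \<in> V" and y: "y \<in> V"
  have "summable (\<lambda>n. step V n x z)"
  proof (rule summableI_nonneg_bounded)
    show "(\<Sum>n<N. step V n x z) \<le> \<phi> x / - laplacian E \<mu> \<phi> z" for N
      using partial_green_sum_le[OF assms(1,2) x, of z N] assms(4)
      by (simp add: field_simps)
  qed (use x step_nonneg in auto)
  \<comment> \<open>The target is moved backwards from \<open>z\<close> to \<open>y\<close> along a
    path, with the starting point \<open>x\<close> fixed.\<close>
  with connected_E[OF y \<open>z \<in> V\<close>] show "summable (\<lambda>n. step V n x y)"
    by (induction rule: converse_rtrancl_induct) (use x summable_step_edge in blast)+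
qed

section \<open>Maximum principle and a point of strict superharmonicity\<close>

lemma maximum_principle:
  assumes harmonic: "\<And>x. x \<in> V \<Longrightarrow> laplacian E \<mu> u x = 0"
    and max: "\<And>x. x \<in> V \<Longrightarrow> u x \<le> u m"
    and "m \<in> V" "x \<in> V"
  shows "u x = u m"
  using connected_E[OF \<open>m \<in> V\<close> \<open>x \<in> V\<close>]
proof (induction rule: rtrancl_induct)
  case (step y z)
  have y: "y \<in> V"
    using step.hyps E_subset by auto
  \<comment> \<open>As \<open>u y = u m\<close>, harmonicity at \<open>y\<close> makes a sum of
    nonnegative terms vanish, so every neighbour of \<open>y\<close> attains the maximum
    too.\<close>
  have "(\<Sum>w\<in>E `` {y}. p y w * (u m - u w)) = - laplacian E \<mu> u y"
    by (simp add: laplacian_eq step.IH algebra_simps flip: sum_negf)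
  also have "\<dots> = 0"
    using harmonic y by simp
  finally have *: "\<forall>w\<in>E `` {y}. p y w * (u m - u w) = 0"
    using locally_finite[OF y]
    by (subst (asm) sum_nonneg_eq_0_iff)
      (auto intro!: mult_nonneg_nonneg transition_nonneg max dest: subsetD[OF E_subset])
  have "p y z * (u m - u z) = 0"
    using * \<open>(y, z) \<in> E\<close> by blast
  then show ?case
    using transition_pos[OF \<open>(y, z) \<in> E\<close>] by simp
qed simp

lemma finite_graph_ball:
  assumes "x\<^sub>0 \<in> V"
  shows "finite (graph_ball V E x\<^sub>0 j)"
proof -
  have fin: "finite {x. (x, x\<^sub>0) \<in> E ^^ n}" for n
  proof (induction n)
    case (Suc n)
    have *: "finite (E `` {y})" for y
      using locally_finite[of y] E_subset by (cases "E `` {y} = {}") auto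
    \<comment> \<open>Symmetry turns the predecessors of \<open>y\<close> into its successors, which
      local finiteness controls.\<close>
    have "{x. (x, x\<^sub>0) \<in> E ^^ Suc n} \<subseteq> (\<Union>y\<in>{x. (x, x\<^sub>0) \<in> E ^^ n}. E `` {y})"
      using sym_E by (fastforce dest!: relpow_Suc_D2 dest: symD simp del: relpow.simps)
    then show ?case
      using Suc.IH * by (meson finite_UN_I finite_subset)
  qed simp
  \<comment> \<open>Connectedness ensures that the \<open>LEAST\<close> in the distance is
    attained.\<close>
  have "(x, x\<^sub>0) \<in> E ^^ graph_dist E x x\<^sub>0" if "x \<in> V" for x
    using connected_E[OF that assms] unfolding graph_dist_def
    by (metis LeastI rtrancl_imp_relpow)
  then have "graph_ball V E x\<^sub>0 j \<subseteq> (\<Union>n<j. {x. (x, x\<^sub>0) \<in> E ^^ n})"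
    unfolding graph_ball_def by auto
  then show ?thesis
    using fin by (meson finite_UN_I finite_lessThan finite_subset)
qed

lemma ex_laplacian_neg:
  assumes "infinite V" "x\<^sub>0 \<in> V"
    and pos: "\<And>x. x \<in> V \<Longrightarrow> \<phi> x > 0"
    and super: "\<And>x. x \<in> V \<Longrightarrow> laplacian E \<mu> \<phi> x \<le> 0"
    and lim: "(\<phi> \<longlongrightarrow> 0) (inf (filtercomap (\<lambda>x. graph_dist E x x\<^sub>0) at_top) (principal V))"
  shows "\<exists>z\<in>V. laplacian E \<mu> \<phi> z < 0"
proof (rule ccontr)
  assume "\<not> ?thesis"
  then have harmonic: "laplacian E \<mu> \<phi> x = 0" if "x \<in> V" for x
    using super that by force
  have "eventually (\<lambda>x. \<phi> x < \<phi> x\<^sub>0)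
      (inf (filtercomap (\<lambda>x. graph_dist E x x\<^sub>0) at_top) (principal V))"
    using lim pos[OF \<open>x\<^sub>0 \<in> V\<close>] by (rule order_tendstoD)
  then obtain N where N: "\<phi> x < \<phi> x\<^sub>0" if "x \<in> V" "graph_dist E x x\<^sub>0 \<ge> N" for x
    unfolding eventually_inf_principal eventually_filtercomap eventually_at_top_linorder
    by blast
  define B where "B = graph_ball V E x\<^sub>0 N"
  have outside: "\<phi> x < \<phi> x\<^sub>0" if "x \<in> V - B" for x
    using N that by (force simp: B_def graph_ball_def)
  \<comment> \<open>The centre lies in \<open>B\<close>, as otherwise \<open>outside\<close> would
    give \<open>\<phi> x\<^sub>0 < \<phi> x\<^sub>0\<close>. Hence the maximum over \<open>B\<close>
    dominates the values outside as well.\<close>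
  have B: "finite B" "B \<subseteq> V" "x\<^sub>0 \<in> B"
    using finite_graph_ball[OF \<open>x\<^sub>0 \<in> V\<close>] outside[of x\<^sub>0] \<open>x\<^sub>0 \<in> V\<close>
    by (auto simp: B_def graph_ball_def)
  have "Max (\<phi> ` B) \<in> \<phi> ` B"
    using B by (intro Max_in) auto
  then obtain m where m: "m \<in> B" "Max (\<phi> ` B) = \<phi> m"
    by blast
  have maxB: "\<phi> x \<le> \<phi> m" if "x \<in> B" for x
    using that B(1) by (simp flip: m(2))
  have "\<phi> x \<le> \<phi> m" if "x \<in> V" for x
    using maxB[of x] maxB[OF B(3)] outside[of x] that by (cases "x \<in> B") auto
  then have const: "\<phi> x = \<phi> m" if "x \<in> V" for x
    using maximum_principle[of \<phi> m x] harmonic m B that by blast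
  \<comment> \<open>Infinitude of \<open>V\<close> supplies a vertex where \<open>\<phi>\<close> is
    strictly below \<open>\<phi> x\<^sub>0\<close>, contradicting constancy.\<close>
  obtain x where "x \<in> V - B"
    using \<open>infinite V\<close> B(1) by (metis Diff_infinite_finite ex_in_conv finite.emptyI)
  then show False
    using outside[of x] const[of x] const[OF \<open>x\<^sub>0 \<in> V\<close>] by auto
qed

section \<open>Exhaustion by balls\<close>

lemma eventually_in_graph_ball:
  assumes "x \<in> V"
  shows "eventually (\<lambda>j. x \<in> graph_ball V E x\<^sub>0 j) sequentially"
  using eventually_gt_at_top[of "graph_dist E x x\<^sub>0"]
  by eventually_elim (use assms in \<open>simp add: graph_ball_def\<close>)

text \<open>Walks of length \<open>n\<close> from \<open>x\<close> visit only finitely many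
  vertices, all inside every large enough ball. In the induction, finiteness of the neighbourhood
  allows one threshold for all neighbours.\<close>

lemma eventually_step_graph_ball:
  "x \<in> V \<Longrightarrow> eventually (\<lambda>j. step (graph_ball V E x\<^sub>0 j) n x y = step V n x y) sequentially"
proof (induction n arbitrary: x)
  case (Suc n)
  have "eventually (\<lambda>j. \<forall>z\<in>E `` {x}. z \<in> graph_ball V E x\<^sub>0 j \<and>
      step (graph_ball V E x\<^sub>0 j) n z y = step V n z y) sequentially"
    using Suc neighbours_subset
    by (intro eventually_ball_finite locally_finite ballI eventually_conj
        eventually_in_graph_ball Suc.IH) auto
  then show ?case
  proof eventually_elim
    case (elim j)
    then have "E `` {x} \<inter> graph_ball V E x\<^sub>0 j = E `` {x}"
      by blast
    with elim show ?case
      by (simp add: step_Suc[OF Suc.prems, of "graph_ball V E x\<^sub>0 j"] step_V_Suc[OF Suc.prems])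
  qed
qed simp

lemma green_graph_ball_tendsto:
  assumes "transient V E \<mu>" "x \<in> V" "y \<in> V"
  shows "(\<lambda>j. green (graph_ball V E x\<^sub>0 j) E \<mu> x y) \<longlonglongrightarrow> green V E \<mu> x y"
proof -
  let ?B = "graph_ball V E x\<^sub>0"
  have "(\<lambda>j. \<Sum>n. step (?B j) n x y) \<longlonglongrightarrow> (\<Sum>n. step V n x y)"
  proof (rule tannerys_theorem[where M = "\<lambda>n. step V n x y", THEN conjunct2, THEN conjunct2])
    show "((\<lambda>j. step (?B j) n x y) \<longlongrightarrow> step V n x y) sequentially" for n
      using eventually_step_graph_ball[OF assms(2)] by (rule tendsto_eventually)
    show "eventually (\<lambda>(n, j). norm (step (?B j) n x y) \<le> step V n x y)
        (at_top \<times>\<^sub>F sequentially)"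
      using step_nonneg[OF assms(2)] step_le[OF assms(2)] by (intro always_eventually) auto
    show "summable (\<lambda>n. step V n x y)"
      using assms unfolding transient_def by blast
  qed simp
  \<comment> \<open>The equality holds once the ball contains both points; before that,
    \<open>green\<close> has the default value 0.\<close>
  moreover have "eventually (\<lambda>j. green (?B j) E \<mu> x y = (\<Sum>n. step (?B j) n x y)) sequentially"
    using assms(2,3)[THEN eventually_in_graph_ball[of _ x\<^sub>0]]
    by eventually_elim (simp add: green_def)
  ultimately show ?thesis
    using assms by (simp add: green_def tendsto_cong)
qed

end

theorem theorem3p1:
  fixes V :: "'a set" and E :: "('a \<times> 'a) set" and \<mu> :: "'a \<Rightarrow> 'a \<Rightarrow> real"
    and x\<^sub>0 :: 'a and \<phi> :: "'a \<Rightarrow> real"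
  assumes "weighted_graph V E \<mu>"
    and "infinite V"
    and "x\<^sub>0 \<in> V"
    and "\<And>x. x \<in> V \<Longrightarrow> \<phi> x > 0"
    and "\<And>x. x \<in> V \<Longrightarrow> laplacian E \<mu> \<phi> x \<le> 0"
    and "(\<phi> \<longlongrightarrow> 0) (inf (filtercomap (\<lambda>x. graph_dist E x x\<^sub>0) at_top) (principal V))"
  shows "\<exists>G :: 'a \<Rightarrow> 'a \<Rightarrow> real.
           (\<forall>x\<in>V. \<forall>y\<in>V. x \<noteq> y \<longrightarrow>
              (\<lambda>j. green (graph_ball V E x\<^sub>0 j) E \<mu> x y) \<longlonglongrightarrow> G x y) \<and>
           transient V E \<mu> \<and> (\<forall>x\<in>V. \<forall>y\<in>V. G x y = green V E \<mu> x y)"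
proof -
  interpret weighted_graph V E \<mu>
    by fact
  obtain z where "z \<in> V" "laplacian E \<mu> \<phi> z < 0"
    using ex_laplacian_neg[OF assms(2-6)] by blast
  then have "transient V E \<mu>"
    using transient_if_strictly_superharmonic[of \<phi> z] assms(4,5) by (simp add: less_imp_le)
  then show ?thesis
    using green_graph_ball_tendsto by (intro exI[of _ "green V E \<mu>"]) blast
qed

end
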